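(* Let $X$ and $Y$ be compact subsets of $\mathbb R$ such that there exists an increasing bijection $f\colon\mathcal Q_X\to\mathcal Q_Y$ satisfying $f[\mathcal G_X]=\mathcal G_Y$. Then there exists an increasing homeomorphism $F\colon\mathbb R\to\mathbb R$ such that $F[X]=Y$.
   Context: For a compact set $Y\subset\mathbb R$: a $Y$-gap is a connected component of $\mathbb R\setminus Y$ (unbounded components included), and a $Y$-interval is a non-trivial (more than one point) connected component of $Y$. $\mathcal G_Y$ is the family of all $Y$-gaps, $\mathcal I_Y$ the family of all $Y$-intervals, and $\mathcal Q_Y=\mathcal G_Y\cup\mathcal I_Y$, linearly ordered by: for distinct $I,J\in\mathcal Q_Y$, $I<J$ if and only if $\sup I\leqslant\inf J$. *)

theory Defs
  imports "HOL-Analysis.Analysis"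
begin

definition gaps :: "real set \<Rightarrow> real set set" where
  "gaps Y = components (- Y)"

definition intervals :: "real set \<Rightarrow> real set set" where
  "intervals Y = {I \<in> components Y. \<not> is_singleton I}"

definition gaps_and_intervals :: "real set \<Rightarrow> real set set" where
  "gaps_and_intervals Y = gaps Y \<union> intervals Y"

text \<open>Suprema and infima are taken in the extended reals, since gaps may be unbounded.\<close>

definition precedes :: "real set \<Rightarrow> real set \<Rightarrow> bool" where
  "precedes I J \<longleftrightarrow> I \<noteq> J \<and> (SUP x\<in>I. ereal x) \<le> (INF y\<in>J. ereal y)"

end

theory Submission
  imports Defs
begin

text \<open>The interiors of the members of \<open>\<Q>\<^sub>X\<close> have dense union. Mapping the interior of each \<open>I\<close> by an
  increasing bijection onto the interior of \<open>f I\<close> gives an increasing map between dense subsets of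
  the line with dense image, and such a map extends to an increasing bijection \<open>F\<close> of the line. As gaps
  are open, \<open>F\<close> maps the union of all \<open>X\<close>-gaps onto the union of all \<open>Y\<close>-gaps.\<close>

text \<open>The extension takes at x the supremum of g over the points of D up to x. Density of D
  makes it strictly increasing; density of the image of D rules out jumps, hence gives
  surjectivity.\<close>

lemma strict_mono_extension:
  fixes g :: "real \<Rightarrow> real"
  assumes mono: "strict_mono_on D g"
    and dense: "\<And>a b. a < b \<Longrightarrow> \<exists>y\<in>D. a < y \<and> y < b"
    and dense_image: "\<And>a b. a < b \<Longrightarrow> \<exists>y\<in>D. a < g y \<and> g y < b"
  obtains F where "strict_mono F" "surj F" "\<And>x. x \<in> D \<Longrightarrow> F x = g x"
proof -
  define F where "F x = Sup (g ` {y\<in>D. y \<le> x})" for x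
  have less: "g y < g z" if "y \<in> D" "z \<in> D" "y < z" for y z
    using mono that by (simp add: strict_mono_on_def)
  have le: "g y \<le> g z" if "y \<in> D" "z \<in> D" "y \<le> z" for y z
    using less[OF that(1,2)] that(3) by (cases "y = z") auto
  have nonempty: "g ` {y\<in>D. y \<le> x} \<noteq> {}" for x
    using dense[of "x - 1" x] by auto
  have upper: "F x \<le> g z" if "z \<in> D" "x \<le> z" for x z
    unfolding F_def using that by (intro cSup_least nonempty) (auto intro!: le)
  have lower: "g y \<le> F x" if "y \<in> D" "y \<le> x" for x y
  proof -
    obtain z where "z \<in> D" "x < z" using dense[of x "x + 1"] by auto
    then have "bdd_above (g ` {y\<in>D. y \<le> x})"
      by (intro bdd_aboveI[of _ "g z"]) (auto intro!: le)
    then show ?thesis unfolding F_def using that by (intro cSup_upper) auto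
  qed
  have F_eq: "F x = g x" if "x \<in> D" for x
    using upper[of x x] lower[of x x] that by simp
  have F_mono: "strict_mono F"
  proof (rule strict_monoI)
    fix x x' :: real assume "x < x'"
    \<comment> \<open>A single point between x and x' would give only a weak inequality; with two, F
      x \<le> g y < g z \<le> F x'.\<close>
    then obtain y where y: "y \<in> D" "x < y" "y < x'" using dense by blast
    then obtain z where z: "z \<in> D" "y < z" "z < x'" using dense by blast
    show "F x < F x'"
      using upper[of y x] lower[of z x'] less[of y z] y z by simp
  qed
  have "\<exists>x. F x = z" for z
  proof -
    \<comment> \<open>The preimage of z is \<open>Sup S\<close>. If its value differed from z,
      density of the image would give a point y of D with g y strictly between them, on the wrong
      side of \<open>Sup S\<close>.\<close>
    define S where "S = {y\<in>D. g y \<le> z}"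
    obtain y0 where y0: "y0 \<in> D" "g y0 < z" using dense_image[of "z - 1" z] by auto
    obtain y1 where y1: "y1 \<in> D" "z < g y1" using dense_image[of z "z + 1"] by auto
    have S_ne: "S \<noteq> {}" using y0 by (auto simp: S_def)
    have "y \<le> y1" if "y \<in> S" for y
      using le[of y1 y] y1 that by (force simp: S_def)
    then have S_bdd: "bdd_above S" by (rule bdd_aboveI)
    have "\<not> F (Sup S) < z"
    proof
      assume "F (Sup S) < z"
      then obtain y where y: "y \<in> D" "F (Sup S) < g y" "g y < z" using dense_image by blast
      then have "Sup S < y" using F_mono by (metis F_eq strict_mono_less)
      moreover have "y \<le> Sup S" using y S_bdd by (intro cSup_upper) (auto simp: S_def)
      ultimately show False by simp
    qed
    moreover have "\<not> z < F (Sup S)"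
    proof
      assume "z < F (Sup S)"
      then obtain y where y: "y \<in> D" "z < g y" "g y < F (Sup S)" using dense_image by blast
      then have "y < Sup S" using F_mono by (metis F_eq strict_mono_less)
      then obtain s where "s \<in> S" "y < s" using less_cSup_iff[OF S_ne S_bdd] by blast
      then show False using less[of y s] y by (auto simp: S_def)
    qed
    ultimately have "F (Sup S) = z" by simp
    then show ?thesis ..
  qed
  then have "surj F" by (metis surjI)
  then show thesis using F_mono F_eq by (intro that)
qed

text \<open>A monotone surjection of the line has no jumps and so is continuous. This applies to F
  and also to its inverse, which is again monotone and onto.\<close>

lemma homeomorphism_strict_mono_surj:
  fixes F :: "real \<Rightarrow> real"
  assumes "strict_mono F" "surj F"
  shows "homeomorphism UNIV UNIV F (inv F)"
proof -
  have inj: "inj F" using assms(1) by (rule strict_mono_imp_inj_on)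
  have "mono (inv F)"
  proof (rule monoI)
    fix x y :: real assume "x \<le> y"
    then have "F (inv F x) \<le> F (inv F y)" using assms(2) by (simp only: surj_f_inv_f)
    then show "inv F x \<le> inv F y" using assms(1) by (simp only: strict_mono_less_eq)
  qed
  moreover have "surj (inv F)" using inj by (rule inj_imp_surj_inv)
  ultimately have "continuous_on UNIV (inv F)"
    by (intro continuous_onI_mono) (auto simp: mono_def)
  moreover have "continuous_on UNIV F"
    using assms by (intro continuous_onI_mono) (auto simp: strict_mono_less_eq)
  ultimately show ?thesis
    using inj assms(2) \<open>surj (inv F)\<close>
    by (auto simp: homeomorphism_def surj_f_inv_f)
qed

text \<open>With the whole line as common model, two intervals of different kinds, such as a bounded
  one and a half-line, can be matched by composing through the line.\<close>

lemma open_interval_strict_mono_range: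
  fixes U :: "real set"
  assumes "open U" "connected U" "U \<noteq> {}"
  obtains h :: "real \<Rightarrow> real" where "strict_mono h" "range h = U"
proof -
  have "U = UNIV \<or> (\<exists>b. U = {..<b}) \<or> (\<exists>a. U = {a<..}) \<or> (\<exists>a b. U = {a<..<b})"
  proof -
    have "is_interval U" using assms(2) by (simp add: is_interval_connected_1)
    then obtain a b where "U \<in> {{}, UNIV, {..<b}, {..b}, {a<..}, {a..}, {a<..<b}, {a<..b}, {a..<b}, {a..b}}"
      using is_real_interval[of U] by auto
    \<comment> \<open>Taking interiors collapses the ten shapes of an interval to five, and U, being
      open, equals its interior.\<close>
    then have "interior U \<in> {{}, UNIV, {..<b}, {a<..}, {a<..<b}}"
      unfolding insert_iff by (elim disjE) (simp_all add: interior_open)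
    then have "U \<in> {UNIV, {..<b}, {a<..}, {a<..<b}}"
      using assms(1,3) by (simp add: interior_open)
    then show ?thesis by blast
  qed
  then consider "U = UNIV" | b where "U = {..<b}" | a where "U = {a<..}"
    | a b where "U = {a<..<b}" by blast
  then show thesis
  proof cases
    case 1
    then show thesis by (intro that[of "\<lambda>x. x"]) (auto simp: strict_mono_def)
  next
    case 2
    have "y \<in> range (\<lambda>x. b - exp (- x))" if "y < b" for y
      using that by (intro range_eqI[of _ _ "- ln (b - y)"]) simp
    with 2 show thesis
      by (intro that[of "\<lambda>x. b - exp (- x)"]) (auto simp: strict_mono_def)
  next
    case 3
    have "y \<in> range (\<lambda>x. a + exp x)" if "a < y" for y
      using that by (intro range_eqI[of _ _ "ln (y - a)"]) simp
    with 3 show thesis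
      by (intro that[of "\<lambda>x. a + exp x"]) (auto simp: strict_mono_def)
  next
    case 4
    have ab: "a < b" using 4 assms(3) by auto
    \<comment> \<open>A rescaled logistic function, tending to a at minus infinity and to b at plus
      infinity. Solving y = \<open>?h\<close> x for exp x gives the argument of the logarithm below,
      which must be positive.\<close>
    let ?h = "\<lambda>x. b - (b - a) / (1 + exp x)"
    have "y \<in> range ?h" if "a < y" "y < b" for y
    proof (rule range_eqI)
      have "0 < (b - a) / (b - y) - 1" using that by (simp add: field_simps)
      then show "y = ?h (ln ((b - a) / (b - y) - 1))" using that by simp
    qed
    moreover have "a < ?h x" "?h x < b" for x
      using ab add_pos_pos[OF zero_less_one exp_gt_zero[of x]] by (auto simp: field_simps)
    ultimately have "range ?h = U" using 4 by auto
    moreover have "strict_mono ?h"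
      using ab by (intro strict_monoI)
        (simp add: divide_strict_left_mono add_pos_pos)
    ultimately show thesis by (rule that[rotated])
  qed
qed

lemma open_intervals_strict_mono_image:
  fixes U V :: "real set"
  assumes "open U" "connected U" "U \<noteq> {}" "open V" "connected V" "V \<noteq> {}"
  shows "\<exists>h. strict_mono_on U h \<and> h ` U = V"
proof -
  obtain p :: "real \<Rightarrow> real" where p: "strict_mono p" "range p = U"
    using open_interval_strict_mono_range assms(1-3) by blast
  obtain q :: "real \<Rightarrow> real" where q: "strict_mono q" "range q = V"
    using open_interval_strict_mono_range assms(4-6) by blast
  have inv_p: "inv p (p x) = x" for x
    using p(1) by (simp add: strict_mono_imp_inj_on)
  have "strict_mono_on U (q \<circ> inv p)"
    using p(1) q(1) unfolding p(2)[symmetric]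
    by (auto intro!: strict_mono_onI simp: inv_p strict_mono_less)
  moreover have "(q \<circ> inv p) ` U = V"
    unfolding p(2)[symmetric] q(2)[symmetric] by (auto simp: inv_p image_iff)
  ultimately show ?thesis by blast
qed

text \<open>If y \<le> u, then x < y \<le> u puts y into I by connectedness; so u < y. If also v
  \<le> u, then v \<le> u < y puts u into J. Both contradict disjointness.\<close>

lemma connected_disjoint_less:
  fixes I J :: "real set"
  assumes "connected I" "connected J" "I \<inter> J = {}" "x \<in> I" "y \<in> J" "x < y" "u \<in> I" "v \<in> J"
  shows "u < v"
proof (rule ccontr)
  assume "\<not> u < v"
  have "u < y"
    using connectedD_interval[of I x u y] assms by fastforce
  then have "u \<in> J"
    using connectedD_interval[of J v y u] assms \<open>\<not> u < v\<close> by fastforce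
  then show False using assms by blast
qed

lemma precedes_iff: "precedes I J \<longleftrightarrow> I \<noteq> J \<and> (\<forall>x\<in>I. \<forall>y\<in>J. x \<le> y)"
  by (auto simp: precedes_def SUP_le_iff le_INF_iff)

lemma gaps_and_intervals_connected:
  "I \<in> gaps_and_intervals X \<Longrightarrow> connected I"
  by (auto simp: gaps_and_intervals_def gaps_def intervals_def in_components_connected)

lemma gaps_and_intervals_disjoint:
  assumes "I \<in> gaps_and_intervals X" "J \<in> gaps_and_intervals X" "I \<noteq> J"
  shows "I \<inter> J = {}"
  using assms components_nonoverlap[of I _ J] in_components_subset[of I] in_components_subset[of J]
  unfolding gaps_and_intervals_def gaps_def intervals_def by fast

text \<open>One pair of points decides the order because the members are connected and pairwise
  disjoint; disjointness also makes the inequality of \<open>precedes_iff\<close> strict.\<close>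

lemma precedes_gaps_and_intervals:
  assumes "I \<in> gaps_and_intervals X" "J \<in> gaps_and_intervals X" "I \<noteq> J"
    and "x \<in> I" "y \<in> J"
  shows "precedes I J \<longleftrightarrow> x < y"
proof
  show "precedes I J" if "x < y"
    using connected_disjoint_less[OF assms(1,2)[THEN gaps_and_intervals_connected]
        gaps_and_intervals_disjoint[OF assms(1-3)] assms(4,5) that] assms(3)
    unfolding precedes_iff by (meson less_imp_le)
  show "x < y" if "precedes I J"
    using that assms(4,5) gaps_and_intervals_disjoint[OF assms(1-3)]
    unfolding precedes_iff less_le by blast
qed

lemma interior_gap:
  assumes "closed X" "I \<in> gaps X"
  shows "interior I = I"
  using assms open_components[of "- X" I] by (simp add: gaps_def interior_open open_Compl)

text \<open>A gap is open and nonempty; a nontrivial component contains two points and hence the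
  open interval between them.\<close>

lemma interior_gaps_and_intervals_nonempty:
  assumes "closed X" "I \<in> gaps_and_intervals X"
  shows "interior I \<noteq> {}"
proof (cases "I \<in> gaps X")
  case True
  then show ?thesis
    using interior_gap[OF assms(1)] in_components_nonempty by (fastforce simp: gaps_def)
next
  case False
  then have I: "I \<in> components X" "\<not> is_singleton I"
    using assms(2) by (auto simp: gaps_and_intervals_def intervals_def)
  then obtain a b where ab: "a \<in> I" "b \<in> I" "a < b"
    using in_components_nonempty[of I X] by (metis is_singletonI' linorder_neqE_linordered_idom)
  then have "{a<..<b} \<subseteq> interior I"
    using connectedD_interval[OF in_components_connected[OF I(1)] ab(1,2)]
    by (intro interior_maximal) auto
  then show ?thesis using dense[OF ab(3)] by auto
qed

text \<open>The open interval from a to b either lies in X, hence inside a single component of X, or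
  meets the complement of X, hence an open gap.\<close>

lemma interiors_dense:
  fixes a b :: real
  assumes "closed X" "a < b"
  shows "\<exists>I \<in> gaps_and_intervals X. \<exists>y \<in> interior I. a < y \<and> y < b"
proof (cases "{a<..<b} \<subseteq> X")
  case True
  \<comment> \<open>Two distinct points c and d show that the component containing them is
    nontrivial.\<close>
  obtain c where c: "a < c" "c < b" using dense[OF assms(2)] by blast
  obtain d where d: "a < d" "d < c" using dense[OF c(1)] by blast
  obtain I where I: "I \<in> components X" "{a<..<b} \<subseteq> I"
    using exists_component_superset[OF True] c True by fastforce
  have "c \<in> I" "d \<in> I" using I(2) c d by auto
  then have "\<not> is_singleton I" using d by (auto simp: is_singleton_def)
  moreover have "c \<in> interior I"
    using I(2) c interior_maximal[of "{a<..<b}" I] by auto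
  ultimately show ?thesis using I(1) c
    by (auto simp: gaps_and_intervals_def intervals_def)
next
  case False
  then obtain y where y: "a < y" "y < b" "y \<in> - X" by fastforce
  then obtain I where I: "I \<in> gaps X" "y \<in> I"
    unfolding gaps_def by (metis UnionE Union_components)
  then have "y \<in> interior I" using interior_gap[OF assms(1)] by simp
  with I y show ?thesis by (auto simp: gaps_and_intervals_def)
qed

theorem theorem2:
  fixes X Y :: "real set"
  assumes "compact X" and "compact Y"
    and "\<exists>f. bij_betw f (gaps_and_intervals X) (gaps_and_intervals Y)
           \<and> monotone_on (gaps_and_intervals X) precedes precedes f
           \<and> f ` gaps X = gaps Y"
  shows "\<exists>F :: real \<Rightarrow> real. strict_mono F \<and> (\<exists>G. homeomorphism UNIV UNIV F G) \<and> F ` X = Y"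
proof -
  let ?Q = "gaps_and_intervals X" and ?R = "gaps_and_intervals Y"
  obtain f where bij: "bij_betw f ?Q ?R" and f_mono: "monotone_on ?Q precedes precedes f"
    and f_gaps: "f ` gaps X = gaps Y"
    using assms(3) by blast
  have closed: "closed X" "closed Y" using assms(1,2) by (auto intro: compact_imp_closed)
  have fR: "f I \<in> ?R" if "I \<in> ?Q" for I using bij that by (rule bij_betwE[THEN bspec])
  \<comment> \<open>On the line connected means convex, and convexity passes to interiors, so both
    interiors are nonempty open intervals.\<close>
  have "\<exists>h. strict_mono_on (interior I) h \<and> h ` interior I = interior (f I)" if "I \<in> ?Q" for I
    using that fR[OF that] interior_gaps_and_intervals_nonempty closed
      gaps_and_intervals_connected
    by (intro open_intervals_strict_mono_image)
      (auto simp: is_interval_connected_1[symmetric] convex_interior is_interval_convex_1)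
  then obtain h where h_mono: "\<And>I. I \<in> ?Q \<Longrightarrow> strict_mono_on (interior I) (h I)"
    and h_image: "\<And>I. I \<in> ?Q \<Longrightarrow> h I ` interior I = interior (f I)"
    by metis
  define D where "D = (\<Union>I\<in>?Q. interior I)"
  \<comment> \<open>By disjointness the description picks the unique member containing x. Points of
    trivial components of X lie in no member; they are outside D, and there g is
    unspecified.\<close>
  define g where "g x = h (THE I. I \<in> ?Q \<and> x \<in> I) x" for x
  have g_eq: "g x = h I x" if "I \<in> ?Q" "x \<in> interior I" for I x
  proof -
    have "x \<in> I" using that interior_subset by blast
    then have "(THE I. I \<in> ?Q \<and> x \<in> I) = I"
      using that(1) gaps_and_intervals_disjoint by (intro the_equality) blast+
    then show ?thesis by (simp add: g_def)
  qed
  have g_image: "g ` interior I = interior (f I)" if "I \<in> ?Q" for I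
    using h_image[OF that] g_eq[OF that] by (metis (no_types, lifting) image_cong)
  have g_mono: "strict_mono_on D g"
  proof (rule strict_mono_onI)
    fix x y assume "x \<in> D" "y \<in> D" and xy: "x < y"
    then obtain I J where I: "I \<in> ?Q" "x \<in> interior I" and J: "J \<in> ?Q" "y \<in> interior J"
      unfolding D_def by blast
    show "g x < g y"
    proof (cases "I = J")
      case True
      then show ?thesis
        using h_mono[OF I(1)] I J xy by (auto simp: g_eq strict_mono_on_def)
    next
      case False
      have "precedes I J"
        using precedes_gaps_and_intervals[OF I(1) J(1) False] I(2) J(2) xy interior_subset by blast
      then have "precedes (f I) (f J)" using f_mono I(1) J(1) by (simp add: monotone_on_def)
      moreover have "g x \<in> f I" "g y \<in> f J"
        using g_image[OF I(1)] g_image[OF J(1)] I(2) J(2) interior_subset by blast+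
      moreover have "f I \<noteq> f J"
        using bij False I(1) J(1) by (auto simp: bij_betw_def inj_on_def)
      ultimately show ?thesis
        using precedes_gaps_and_intervals fR I(1) J(1) by blast
    qed
  qed
  have D_dense: "\<exists>y\<in>D. a < y \<and> y < b" if "a < b" for a b
    using interiors_dense[OF closed(1) that] unfolding D_def by blast
  \<comment> \<open>The interiors of the members for Y are dense as well, and each is the image
    under g of some interior for X because f is onto.\<close>
  have gD_dense: "\<exists>y\<in>D. a < g y \<and> g y < b" if ab: "a < b" for a b
  proof -
    obtain J z where J: "J \<in> ?R" "z \<in> interior J" and z: "a < z" "z < b"
      using interiors_dense[OF closed(2) ab] by blast
    obtain I where I: "I \<in> ?Q" "J = f I" using bij J(1) by (auto simp: bij_betw_def)
    then obtain y where "y \<in> interior I" "z = g y" using g_image J(2) by blast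
    with z I show ?thesis unfolding D_def by blast
  qed
  obtain F where F: "strict_mono F" "surj F" and F_eq: "\<And>x. x \<in> D \<Longrightarrow> F x = g x"
    using strict_mono_extension[OF g_mono D_dense gD_dense] by blast
  \<comment> \<open>A gap is its own interior, so it lies entirely in D, where F agrees with g.
    Intervals may lose endpoints there and do not cover X, so the set is recovered from its
    complement.\<close>
  have "F ` I = f I" if "I \<in> gaps X" for I
  proof -
    have Q: "I \<in> ?Q" using that by (simp add: gaps_and_intervals_def)
    have "f I \<in> gaps Y" using f_gaps that by blast
    then have "g ` I = f I"
      using g_image[OF Q] interior_gap closed that by metis
    moreover have "I \<subseteq> D"
      using Q interior_gap[OF closed(1) that] unfolding D_def by blast
    ultimately show ?thesis using F_eq by (metis image_cong subsetD)
  qed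
  then have "F ` \<Union>(gaps X) = \<Union>(f ` gaps X)" by (auto simp: image_Union)
  then have "F ` (- X) = - Y" by (simp add: f_gaps) (simp add: gaps_def)
  then have "F ` X = Y"
    using F by (metis bij_image_Compl_eq bij_def double_complement strict_mono_imp_inj_on)
  with F homeomorphism_strict_mono_surj[OF F] show ?thesis by blast
qed

end
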